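(* Fix integers $n_r,n_q\ge1$, symmetric positive definite $M_r\in\mathbb{R}^{n_r\times n_r}$, $M_q\in\mathbb{R}^{n_q\times n_q}$, an arbitrary matrix $G_r\in\mathbb{R}^{n_q\times n_r}$, stiffness coefficients $\gamma_r\in\mathbb{R}^{n_r\times n_r}$, $\gamma_q\in\mathbb{R}^{n_q\times n_q}$ (in particular positive scalars), and $N_{\mathrm{real}}>0$. Suppose that for $i\in\{1,2\}$, $(r_i(t),\mu_i(t))\in\mathbb{R}^{n_r}\times\mathcal P^1(\mathbb{R}^{n_q})$ are solutions of the linear partially kinetic system (defined in the context) with initial conditions $r_i(0)=r^{\mathrm{in}}_i$, $\dot r_i(0)=s^{\mathrm{in}}_i$, $\mu_i(0)=\mu^{\mathrm{in}}_i$. Then there are constants $L,C>0$, independent of the initial conditions, such that for all $t\ge0$ $$\|r_1(t)-r_2(t)\|+\|\dot r_1(t)-\dot r_2(t)\|+W_1(\mu_1(t),\mu_2(t))\le Ce^{Lt}\Big(\|r^{\mathrm{in}}_1-r^{\mathrm{in}}_2\|+\|s^{\mathrm{in}}_1-s^{\mathrm{in}}_2\|+W_1(\mu^{\mathrm{in}}_1,\mu^{\mathrm{in}}_2)\Big).$$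
   Context: $\mathcal P^1(\mathbb{R}^{n_q})$ is the set of Borel probability measures on $\mathbb{R}^{n_q}$ with finite first moment; $\|\cdot\|$ is the Euclidean norm. For a measurable map $\varphi$, $\varphi\#\mu(A):=\mu(\varphi^{-1}(A))$ is the pushforward. Monge–Kantorovich distance: $W_1(\nu,\mu)=\sup\{|\int\phi\,d\nu-\int\phi\,d\mu| : \phi:\mathbb{R}^{n_q}\to\mathbb{R},\ \mathrm{Lip}(\phi)\le1\}$, where $\mathrm{Lip}(\phi)=\sup_{x\ne y}|\phi(x)-\phi(y)|/\|x-y\|$. Linear partially kinetic system: given initial data $r^{\mathrm{in}},s^{\mathrm{in}}\in\mathbb{R}^{n_r}$, $\mu^{\mathrm{in}}\in\mathcal P^1(\mathbb{R}^{n_q})$, a solution consists of a twice differentiable $r:[0,\infty)\to\mathbb{R}^{n_r}$, a characteristic flow $Q:[0,\infty)\times\mathbb{R}^{n_q}\to\mathbb{R}^{n_q}$ differentiable in $t$, and measures $\mu^t$ such that $$\Big(M_r+N_{\mathrm{real}}\int_{\mathbb{R}^{n_q}}G_r^TM_qG_r\,d\mu^t(q)\Big)\ddot r(t)=-\gamma_r r(t)+N_{\mathrm{real}}G_r^T\gamma_q\int_{\mathbb{R}^{n_q}}q\,d\mu^t(q),$$ $$\partial_t Q(t,q^{\mathrm{in}})=-G_r\dot r(t),\quad Q(0,q^{\mathrm{in}})=q^{\mathrm{in}}\ \text{for all }q^{\mathrm{in}}\in\mathbb{R}^{n_q},\qquad \mu^t=Q(t,\cdot)\#\mu^{\mathrm{in}},$$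 with $r(0)=r^{\mathrm{in}}$, $\dot r(0)=s^{\mathrm{in}}$; the pair $(r(t),\mu^t)$ is called the solution. *)

theory Defs
  imports "HOL-Probability.Probability"
begin

text \<open>P^1: Borel probability measures with finite first moment.\<close>
definition P1 :: "('a::euclidean_space) measure \<Rightarrow> bool" where
  "P1 \<mu> \<longleftrightarrow> prob_space \<mu> \<and> sets \<mu> = sets borel \<and> integrable \<mu> (\<lambda>q. norm q)"

text \<open>Monge-Kantorovich distance W_1 (sup over functions with Lip at most 1).\<close>
definition W1 :: "('a::euclidean_space) measure \<Rightarrow> 'a measure \<Rightarrow> real" where
  "W1 \<nu> \<mu> = Sup {\<bar>(\<integral>x. \<phi> x \<partial>\<nu>) - (\<integral>x. \<phi> x \<partial>\<mu>)\<bar> | \<phi>. 1-lipschitz_on UNIV \<phi>}"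

definition sym_pos_def_mat :: "real^'n^'n \<Rightarrow> bool" where
  "sym_pos_def_mat M \<longleftrightarrow> transpose M = M \<and> (\<forall>x. x \<noteq> 0 \<longrightarrow> x \<bullet> (M *v x) > 0)"

text \<open>Solution of the linear partially kinetic system with initial data (rin0, sin0, muin).
  r is the position, s its derivative (velocity), mu t the measures; the second derivative
  of r and the characteristic flow Q are existentially quantified.\<close>
definition lpk_solution ::
  "real^'r^'r \<Rightarrow> real^'q^'q \<Rightarrow> real^'r^'q \<Rightarrow> real^'r^'r \<Rightarrow> real^'q^'q \<Rightarrow> real \<Rightarrow>
   real^'r \<Rightarrow> real^'r \<Rightarrow> (real^'q) measure \<Rightarrow>
   (real \<Rightarrow> real^'r) \<Rightarrow> (real \<Rightarrow> real^'r) \<Rightarrow> (real \<Rightarrow> (real^'q) measure) \<Rightarrow> bool" where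
  "lpk_solution Mr Mq Gr \<gamma>r \<gamma>q Nreal rin0 sin0 \<mu>in r s \<mu> \<longleftrightarrow>
     r 0 = rin0 \<and> s 0 = sin0 \<and>
     (\<exists>r'' Q.
        (\<forall>t\<ge>0. (r has_vector_derivative s t) (at t within {0..}) \<and>
                (s has_vector_derivative r'' t) (at t within {0..}) \<and>
                (Mr + Nreal *\<^sub>R (\<integral>q. transpose Gr ** Mq ** Gr \<partial>(\<mu> t))) *v r'' t
                  = - (\<gamma>r *v r t) + Nreal *\<^sub>R ((transpose Gr ** \<gamma>q) *v (\<integral>q. q \<partial>(\<mu> t)))) \<and>
        (\<forall>q. Q 0 q = q) \<and>
        (\<forall>t\<ge>0. \<forall>q. ((\<lambda>\<tau>. Q \<tau> q) has_vector_derivative (- (Gr *v s t))) (at t within {0..})) \<and>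
        (\<forall>t\<ge>0. Q t \<in> borel_measurable \<mu>in \<and> \<mu> t = distr \<mu>in borel (Q t)))"

end

theory Submission
  imports Defs
begin

text \<open>
  The characteristic flow depends only on the particle position: from dQ/dt = -Gr r' and
  Q(0) = id one gets Q(t, q) = q - Gr (r(t) - r(0)). Hence mu(t) is a translate of mu_in, its
  mean moves with r, and the mass matrix Mr + N Gr^T Mq Gr is constant and positive definite,
  so the system collapses to the linear ODE r'' = F (m_in + Gr r(0)) - S r, where m_in is the
  mean of mu_in and F, S are the matrices forcing and stiffness below. For two solutions the
  difference d = r1 - r2 satisfies |d''| \<le> |S| |d| + k, with k controlled by |d(0)| and
  W1(mu_in1, mu_in2) because the means differ by at most W1; a Gronwall argument for
  |d|^2 + |d'|^2 + k^2 gives exponential growth. Finally, translating two measures by a and b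
  changes their W1 distance by at most |a - b|.
\<close>

lemma measurable_P1: "P1 \<mu> \<Longrightarrow> measurable \<mu> N = measurable borel N"
  unfolding P1_def by (intro measurable_cong_sets) auto

lemma prob_space_P1: "P1 \<mu> \<Longrightarrow> prob_space \<mu>"
  unfolding P1_def by simp

lemma integrable_norm_P1: "P1 \<mu> \<Longrightarrow> integrable \<mu> norm"
  unfolding P1_def by simp

lemma integrable_id_P1:
  fixes \<mu> :: "'a::euclidean_space measure"
  assumes "P1 \<mu>" shows "integrable \<mu> (\<lambda>x. x)"
proof (rule integrable_norm_cancel)
  show "integrable \<mu> norm" using assms by (rule integrable_norm_P1)
  show "(\<lambda>x. x) \<in> borel_measurable \<mu>" unfolding measurable_P1[OF assms] by measurable
qed

lemma lipschitz_integrable_P1: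
  fixes \<phi> :: "'a::euclidean_space \<Rightarrow> real"
  assumes P: "P1 \<mu>" and lip: "C-lipschitz_on UNIV \<phi>"
  shows "integrable \<mu> \<phi>"
proof (rule Bochner_Integration.integrable_bound)
  interpret prob_space \<mu> using P by (rule prob_space_P1)
  show "integrable \<mu> (\<lambda>x. \<bar>\<phi> 0\<bar> + C * norm x)"
    using integrable_norm_P1[OF P] by auto
  show "\<phi> \<in> borel_measurable \<mu>"
    unfolding measurable_P1[OF P]
    by (intro borel_measurable_continuous_onI lipschitz_on_continuous_on[OF lip])
  show "AE x in \<mu>. norm (\<phi> x) \<le> norm (\<bar>\<phi> 0\<bar> + C * norm x)"
  proof (rule AE_I2)
    fix x
    have "\<bar>\<phi> x - \<phi> 0\<bar> \<le> C * norm x"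
      using lipschitz_onD[OF lip, of x 0] by (simp add: dist_norm)
    then show "norm (\<phi> x) \<le> norm (\<bar>\<phi> 0\<bar> + C * norm x)" by auto
  qed
qed

lemma abs_integral_lipschitz_minus_le:
  fixes \<phi> :: "'a::euclidean_space \<Rightarrow> real"
  assumes P: "P1 \<mu>" and lip: "C-lipschitz_on UNIV \<phi>"
  shows "\<bar>(\<integral>x. \<phi> x \<partial>\<mu>) - \<phi> 0\<bar> \<le> C * (\<integral>x. norm x \<partial>\<mu>)"
proof -
  interpret prob_space \<mu> using P by (rule prob_space_P1)
  have int: "integrable \<mu> \<phi>" using P lip by (rule lipschitz_integrable_P1)
  have "\<bar>(\<integral>x. \<phi> x \<partial>\<mu>) - \<phi> 0\<bar> = \<bar>\<integral>x. \<phi> x - \<phi> 0 \<partial>\<mu>\<bar>"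
    using int by (simp add: prob_space)
  also have "\<dots> \<le> (\<integral>x. C * norm x \<partial>\<mu>)"
  proof (rule integral_abs_bound_integral)
    show "integrable \<mu> (\<lambda>x. \<phi> x - \<phi> 0)" using int by simp
    show "integrable \<mu> (\<lambda>x. C * norm x)" using integrable_norm_P1[OF P] by simp
    show "\<bar>\<phi> x - \<phi> 0\<bar> \<le> C * norm x" for x
      using lipschitz_onD[OF lip, of x 0] by (simp add: dist_norm)
  qed
  finally show ?thesis by simp
qed

lemma bdd_above_W1_set:
  fixes \<nu> :: "'a::euclidean_space measure"
  assumes "P1 \<nu>" "P1 \<mu>"
  shows "bdd_above ({\<bar>(\<integral>x. \<phi> x \<partial>\<nu>) - (\<integral>x. \<phi> x \<partial>\<mu>)\<bar> | \<phi>. 1-lipschitz_on UNIV \<phi>} :: real set)"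
proof (rule bdd_aboveI)
  fix y :: real assume "y \<in> {\<bar>(\<integral>x. \<phi> x \<partial>\<nu>) - (\<integral>x. \<phi> x \<partial>\<mu>)\<bar> | \<phi>. 1-lipschitz_on UNIV \<phi>}"
  then obtain \<phi> :: "'a \<Rightarrow> real"
    where y: "y = \<bar>(\<integral>x. \<phi> x \<partial>\<nu>) - (\<integral>x. \<phi> x \<partial>\<mu>)\<bar>" and lip: "1-lipschitz_on UNIV \<phi>"
    by blast
  show "y \<le> (\<integral>x. norm x \<partial>\<nu>) + (\<integral>x. norm x \<partial>\<mu>)"
    using abs_integral_lipschitz_minus_le[OF assms(1) lip] abs_integral_lipschitz_minus_le[OF assms(2) lip]
    unfolding y by linarith
qed

lemma W1_ge:
  fixes \<phi> :: "'a::euclidean_space \<Rightarrow> real"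
  assumes "P1 \<nu>" "P1 \<mu>" and "1-lipschitz_on UNIV \<phi>"
  shows "\<bar>(\<integral>x. \<phi> x \<partial>\<nu>) - (\<integral>x. \<phi> x \<partial>\<mu>)\<bar> \<le> W1 \<nu> \<mu>"
  unfolding W1_def using assms by (intro cSup_upper bdd_above_W1_set) auto

lemma W1_le:
  fixes \<nu> :: "'a::euclidean_space measure"
  assumes "\<And>\<phi>. 1-lipschitz_on UNIV \<phi> \<Longrightarrow> \<bar>(\<integral>x. \<phi> x \<partial>\<nu>) - (\<integral>x. \<phi> x \<partial>\<mu>)\<bar> \<le> B"
  shows "W1 \<nu> \<mu> \<le> B"
proof -
  have "1-lipschitz_on UNIV (\<lambda>x::'a. 0::real)" by (auto intro: lipschitz_onI)
  then show ?thesis unfolding W1_def using assms by (intro cSup_least) auto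
qed

lemma W1_nonneg:
  fixes \<nu> :: "'a::euclidean_space measure"
  assumes "P1 \<nu>" "P1 \<mu>" shows "0 \<le> W1 \<nu> \<mu>"
proof -
  have "1-lipschitz_on UNIV (\<lambda>_::'a. 0::real)" by (auto intro: lipschitz_onI)
  from W1_ge[OF assms this] show ?thesis by simp
qed

lemma norm_mean_diff_le_W1:
  fixes \<nu> :: "'a::euclidean_space measure"
  assumes P: "P1 \<nu>" "P1 \<mu>"
  shows "norm ((\<integral>x. x \<partial>\<nu>) - (\<integral>x. x \<partial>\<mu>)) \<le> W1 \<nu> \<mu>"
proof -
  define v where "v = (\<integral>x. x \<partial>\<nu>) - (\<integral>x. x \<partial>\<mu>)"
  define u where "u = sgn v"
  have lip: "1-lipschitz_on UNIV (\<lambda>x. u \<bullet> x)"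
  proof (rule lipschitz_onI)
    fix x y
    have "\<bar>u \<bullet> (x - y)\<bar> \<le> norm u * norm (x - y)" by (rule Cauchy_Schwarz_ineq2)
    also have "\<dots> \<le> 1 * dist x y" by (simp add: u_def norm_sgn dist_norm mult_left_le_one_le)
    finally show "dist (u \<bullet> x) (u \<bullet> y) \<le> 1 * dist x y" by (simp add: dist_norm inner_diff_right)
  qed simp
  have "norm v = u \<bullet> v"
    by (cases "v = 0") (simp_all add: u_def sgn_div_norm power2_norm_eq_inner[symmetric] power2_eq_square)
  also have "\<dots> = (\<integral>x. u \<bullet> x \<partial>\<nu>) - (\<integral>x. u \<bullet> x \<partial>\<mu>)"
    using integrable_id_P1[OF P(1)] integrable_id_P1[OF P(2)] by (simp add: v_def inner_diff_right)
  also have "\<dots> \<le> W1 \<nu> \<mu>"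
    using W1_ge[OF P lip] by linarith
  finally show ?thesis unfolding v_def .
qed

lemma translate_measurable_P1:
  fixes \<mu> :: "'a::euclidean_space measure"
  assumes "P1 \<mu>" shows "(\<lambda>q. q - c) \<in> measurable \<mu> borel"
  unfolding measurable_P1[OF assms] by measurable

lemma P1_distr_translate:
  fixes \<mu> :: "'a::euclidean_space measure"
  assumes "P1 \<mu>" shows "P1 (distr \<mu> borel (\<lambda>q. q - c))"
proof -
  interpret prob_space \<mu> using assms by (rule prob_space_P1)
  have "integrable \<mu> (\<lambda>q. norm (q - c))"
    using integrable_id_P1[OF assms] by simp
  then show ?thesis
    unfolding P1_def using translate_measurable_P1[OF assms]
    by (simp add: prob_space_distr integrable_distr_eq)
qed

lemma integral_id_distr_translate:
  fixes \<mu> :: "'a::euclidean_space measure"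
  assumes "P1 \<mu>" shows "(\<integral>q. q \<partial>distr \<mu> borel (\<lambda>q. q - c)) = (\<integral>q. q \<partial>\<mu>) - c"
proof -
  interpret prob_space \<mu> using assms by (rule prob_space_P1)
  have "(\<integral>q. q \<partial>distr \<mu> borel (\<lambda>q. q - c)) = (\<integral>q. q - c \<partial>\<mu>)"
    by (rule integral_distr[OF translate_measurable_P1[OF assms]]) simp
  also have "\<dots> = (\<integral>q. q \<partial>\<mu>) - c"
    using integrable_id_P1[OF assms] by (simp add: prob_space)
  finally show ?thesis .
qed

lemma W1_distr_translate_le:
  fixes \<mu>1 :: "'a::euclidean_space measure"
  assumes P: "P1 \<mu>1" "P1 \<mu>2"
  shows "W1 (distr \<mu>1 borel (\<lambda>q. q - a)) (distr \<mu>2 borel (\<lambda>q. q - b)) \<le> W1 \<mu>1 \<mu>2 + norm (a - b)"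
proof (rule W1_le)
  fix \<phi> :: "'a \<Rightarrow> real"
  assume lip: "1-lipschitz_on UNIV \<phi>"
  have lip_translate: "1-lipschitz_on UNIV (\<lambda>q. \<phi> (q - c))" for c
  proof (rule lipschitz_onI)
    show "dist (\<phi> (x - c)) (\<phi> (y - c)) \<le> 1 * dist x y" for x y
      using lipschitz_onD[OF lip, of "x - c" "y - c"] by (simp add: dist_norm)
  qed simp
  have integral_translate: "(\<integral>x. \<phi> x \<partial>distr \<mu> borel (\<lambda>q. q - c)) = (\<integral>q. \<phi> (q - c) \<partial>\<mu>)"
    if "P1 \<mu>" for \<mu> c
    using translate_measurable_P1[OF that]
    by (rule integral_distr) (intro borel_measurable_continuous_onI lipschitz_on_continuous_on[OF lip])
  interpret \<mu>2: prob_space \<mu>2 using P(2) by (rule prob_space_P1)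
  have "\<bar>(\<integral>q. \<phi> (q - a) \<partial>\<mu>2) - (\<integral>q. \<phi> (q - b) \<partial>\<mu>2)\<bar> = \<bar>\<integral>q. \<phi> (q - a) - \<phi> (q - b) \<partial>\<mu>2\<bar>"
    using lipschitz_integrable_P1[OF P(2) lip_translate] by simp
  also have "\<dots> \<le> (\<integral>q. norm (a - b) \<partial>\<mu>2)"
  proof (rule integral_abs_bound_integral)
    show "integrable \<mu>2 (\<lambda>q. \<phi> (q - a) - \<phi> (q - b))"
      using lipschitz_integrable_P1[OF P(2) lip_translate] by simp
    show "\<bar>\<phi> (q - a) - \<phi> (q - b)\<bar> \<le> norm (a - b)" for q
      using lipschitz_onD[OF lip, of "q - a" "q - b"] by (simp add: dist_norm norm_minus_commute)
  qed simp
  finally have shift: "\<bar>(\<integral>q. \<phi> (q - a) \<partial>\<mu>2) - (\<integral>q. \<phi> (q - b) \<partial>\<mu>2)\<bar> \<le> norm (a - b)"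
    by (simp add: \<mu>2.prob_space)
  have "\<bar>(\<integral>q. \<phi> (q - a) \<partial>\<mu>1) - (\<integral>q. \<phi> (q - a) \<partial>\<mu>2)\<bar> \<le> W1 \<mu>1 \<mu>2"
    by (rule W1_ge[OF P lip_translate])
  with shift show "\<bar>(\<integral>x. \<phi> x \<partial>distr \<mu>1 borel (\<lambda>q. q - a)) - (\<integral>x. \<phi> x \<partial>distr \<mu>2 borel (\<lambda>q. q - b))\<bar>
      \<le> W1 \<mu>1 \<mu>2 + norm (a - b)"
    unfolding integral_translate[OF P(1)] integral_translate[OF P(2)] by linarith
qed

lemma exp_growth_bound:
  fixes f f' :: "real \<Rightarrow> real"
  assumes deriv: "\<And>s. 0 \<le> s \<Longrightarrow> (f has_real_derivative f' s) (at s within {0..})"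
    and growth: "\<And>s. 0 \<le> s \<Longrightarrow> f' s \<le> L * f s"
    and "0 \<le> t"
  shows "f t \<le> f 0 * exp (L * t)"
proof -
  define g where "g s = f s * exp (- L * s)" for s
  define g' where "g' s = (f' s - L * f s) * exp (- L * s)" for s
  have "(g has_real_derivative g' s) (at s within {0..t})" if "0 \<le> s" for s
  proof -
    have "(f has_real_derivative f' s) (at s within {0..t})"
      using deriv[OF that] by (rule has_field_derivative_subset) auto
    then show ?thesis
      unfolding g_def g'_def by (auto intro!: derivative_eq_intros simp: algebra_simps)
  qed
  then obtain s where s: "s \<in> {0..t}" and mvt: "g t - g 0 = g' s * (t - 0)"
    using mvt_very_simple[OF \<open>0 \<le> t\<close>, of g "\<lambda>s. (*) (g' s)"]
    by (auto simp: has_field_derivative_def)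
  have "g' s \<le> 0"
    using growth[of s] s unfolding g'_def by (simp add: mult_nonpos_nonneg)
  then have "g t \<le> g 0"
    using mvt mult_nonpos_nonneg[of "g' s" t] \<open>0 \<le> t\<close> by simp
  then show ?thesis
    unfolding g_def by (simp add: exp_minus field_simps)
qed

lemma energy_rate_le:
  fixes d e a :: "'a::real_inner"
  assumes "norm a \<le> K * norm d + k" and "0 \<le> K"
  shows "2 * (d \<bullet> e) + 2 * (e \<bullet> a) \<le> (2 + K) * (norm d^2 + norm e^2 + k^2)"
proof -
  define x y where "x = norm d" and "y = norm e"
  have amgm: "2 * (u * v) \<le> u^2 + v^2" for u v :: real
    using sum_squares_bound[of u v] by (simp add: power2_eq_square)
  have "d \<bullet> e \<le> x * y"
    unfolding x_def y_def by (rule norm_cauchy_schwarz)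
  moreover have "e \<bullet> a \<le> K * (x * y) + k * y"
    using norm_cauchy_schwarz[of e a] mult_left_mono[OF assms(1), of y]
    unfolding x_def y_def by (simp add: algebra_simps)
  moreover have "2 * (K * (x * y)) \<le> K * x^2 + K * y^2"
    using mult_left_mono[OF amgm[of x y] \<open>0 \<le> K\<close>] by (simp add: algebra_simps)
  moreover have "(2 + K) * (x^2 + y^2 + k^2) = 2 * x^2 + 2 * y^2 + 2 * k^2 + K * x^2 + K * y^2 + K * k^2"
    by (simp add: algebra_simps)
  moreover have "0 \<le> K * k^2" "0 \<le> x^2" "0 \<le> k^2"
    using \<open>0 \<le> K\<close> by simp_all
  ultimately show ?thesis
    unfolding x_def[symmetric] y_def[symmetric] using amgm[of x y] amgm[of k y] by linarith
qed

lemma norm_sum_le_of_energy_le: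
  fixes x y x0 y0 :: "'a::real_normed_vector"
  assumes "norm x^2 + norm y^2 + k^2 \<le> (norm x0^2 + norm y0^2 + k^2) * c" and "1 \<le> c" and "0 \<le> k"
  shows "norm x + norm y \<le> 2 * (norm x0 + norm y0 + k) * c"
proof (rule power2_le_imp_le)
  define X where "X = norm x0 + norm y0 + k"
  have "norm x0^2 + norm y0^2 + k^2 \<le> X^2"
    using \<open>0 \<le> k\<close> mult_nonneg_nonneg[of "norm x0" "norm y0"] mult_nonneg_nonneg[of "norm x0" k]
      mult_nonneg_nonneg[of "norm y0" k]
    unfolding X_def by (simp add: power2_eq_square algebra_simps)
  then have "(norm x0^2 + norm y0^2 + k^2) * c \<le> X^2 * c^2"
    using \<open>1 \<le> c\<close> by (intro mult_mono) (simp_all add: power2_eq_square)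
  have "(norm x + norm y)^2 \<le> 2 * (norm x^2 + norm y^2)"
    using sum_squares_bound[of "norm x" "norm y"] by (simp add: power2_eq_square algebra_simps)
  also have "\<dots> \<le> 2 * (norm x^2 + norm y^2 + k^2)"
    by simp
  also have "\<dots> \<le> 2 * (X^2 * c^2)"
    using order_trans[OF assms(1) \<open>(norm x0^2 + norm y0^2 + k^2) * c \<le> X^2 * c^2\<close>] by simp
  also have "\<dots> \<le> (2 * X * c)^2"
    by (simp add: power_mult_distrib)
  finally show "(norm x + norm y)^2 \<le> (2 * X * c)^2" .
  show "0 \<le> 2 * X * c"
    using \<open>0 \<le> k\<close> \<open>1 \<le> c\<close> unfolding X_def by simp
qed

lemma second_order_growth_bound:
  fixes d e a :: "real \<Rightarrow> 'a::real_inner"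
  assumes d': "\<And>s. 0 \<le> s \<Longrightarrow> (d has_vector_derivative e s) (at s within {0..})"
    and e': "\<And>s. 0 \<le> s \<Longrightarrow> (e has_vector_derivative a s) (at s within {0..})"
    and a_le: "\<And>s. 0 \<le> s \<Longrightarrow> norm (a s) \<le> K * norm (d s) + k"
    and "0 \<le> K" "0 \<le> k" "0 \<le> t"
  shows "norm (d t) + norm (e t) \<le> 2 * (norm (d 0) + norm (e 0) + k) * exp ((2 + K) * t)"
proof (rule norm_sum_le_of_energy_le)
  define E where "E s = norm (d s)^2 + norm (e s)^2 + k^2" for s
  have "(E has_real_derivative 2 * (d s \<bullet> e s) + 2 * (e s \<bullet> a s)) (at s within {0..})"
    if "0 \<le> s" for s
    using d'[OF that] e'[OF that] unfolding E_def power2_norm_eq_inner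
    by (auto intro!: derivative_eq_intros simp: has_vector_derivative_def has_field_derivative_def
        inner_commute algebra_simps)
  moreover have "2 * (d s \<bullet> e s) + 2 * (e s \<bullet> a s) \<le> (2 + K) * E s" if "0 \<le> s" for s
    unfolding E_def using a_le[OF that] \<open>0 \<le> K\<close> by (rule energy_rate_le)
  ultimately have "E t \<le> E 0 * exp ((2 + K) * t)"
    using \<open>0 \<le> t\<close> by (rule exp_growth_bound)
  then show "norm (d t)^2 + norm (e t)^2 + k^2 \<le> (norm (d 0)^2 + norm (e 0)^2 + k^2) * exp ((2 + K) * t)"
    unfolding E_def .
  show "1 \<le> exp ((2 + K) * t)"
    using \<open>0 \<le> K\<close> \<open>0 \<le> t\<close> by simp
qed (rule \<open>0 \<le> k\<close>)

lemma flow_eq_translation: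
  fixes G :: "real^'n^'m"
  assumes r': "\<And>t. 0 \<le> t \<Longrightarrow> (r has_vector_derivative s t) (at t within {0..})"
    and x': "\<And>t. 0 \<le> t \<Longrightarrow> (x has_vector_derivative - (G *v s t)) (at t within {0..})"
    and "0 \<le> t"
  shows "x t = x 0 - G *v (r t - r 0)"
proof -
  have "((\<lambda>\<tau>. x \<tau> + G *v r \<tau>) has_vector_derivative 0) (at \<tau> within {0..})" if "\<tau> \<in> {0..}" for \<tau>
  proof -
    from that have "0 \<le> \<tau>" by simp
    have "((\<lambda>\<tau>. G *v r \<tau>) has_vector_derivative G *v s \<tau>) (at \<tau> within {0..})"
      using bounded_linear.has_vector_derivative[OF matrix_vector_mul_bounded_linear r'[OF \<open>0 \<le> \<tau>\<close>]] .
    from has_vector_derivative_add[OF x'[OF \<open>0 \<le> \<tau>\<close>] this] show ?thesis by simp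
  qed
  then obtain c where "\<And>\<tau>. \<tau> \<in> {0..} \<Longrightarrow> x \<tau> + G *v r \<tau> = c"
    using has_vector_derivative_zero_constant[OF convex_real_interval(1)] by blast
  from this[of t] this[of 0] \<open>0 \<le> t\<close> show ?thesis
    by (simp add: matrix_vector_mult_diff_distrib algebra_simps)
qed

lemma inner_vector_matrix_mult:
  fixes G :: "real^'n^'m"
  shows "x \<bullet> (y v* G) = (G *v x) \<bullet> y"
  by (metis dot_lmul_matrix inner_commute)

lemma invertible_if_pos_def:
  fixes A :: "real^'n^'n"
  assumes "\<And>x. x \<noteq> 0 \<Longrightarrow> 0 < x \<bullet> (A *v x)"
  shows "invertible A"
proof -
  have "inj ((*v) A)"
  proof (rule injI)
    fix x y assume "A *v x = A *v y"
    then have "(x - y) \<bullet> (A *v (x - y)) = 0"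
      by (simp add: matrix_vector_mult_diff_distrib)
    then show "x = y"
      using assms[of "x - y"] by force
  qed
  then show ?thesis
    using matrix_left_invertible_injective invertible_left_inverse by blast
qed

lemma matrix_inv_left:
  fixes A :: "'a::semiring_1^'n^'m"
  assumes "invertible A"
  shows "matrix_inv A ** A = mat 1"
  using assms unfolding invertible_def matrix_inv_def by (rule someI2_ex) simp

lemma mass_matrix_pos_def:
  fixes Mr :: "real^'r^'r" and Mq :: "real^'q^'q" and G :: "real^'r^'q"
  assumes "sym_pos_def_mat Mr" and "sym_pos_def_mat Mq" and "0 \<le> N" and "x \<noteq> 0"
  shows "0 < x \<bullet> ((Mr + N *\<^sub>R (transpose G ** Mq ** G)) *v x)"
proof -
  have "0 \<le> (G *v x) \<bullet> (Mq *v (G *v x))"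
    using \<open>sym_pos_def_mat Mq\<close> unfolding sym_pos_def_mat_def
    by (cases "G *v x = 0") (auto intro: less_imp_le)
  moreover have "0 < x \<bullet> (Mr *v x)"
    using \<open>sym_pos_def_mat Mr\<close> \<open>x \<noteq> 0\<close> unfolding sym_pos_def_mat_def by simp
  moreover have "x \<bullet> ((Mr + N *\<^sub>R (transpose G ** Mq ** G)) *v x)
      = x \<bullet> (Mr *v x) + N * ((G *v x) \<bullet> (Mq *v (G *v x)))"
    by (simp add: matrix_vector_mult_add_rdistrib scaleR_matrix_vector_assoc[symmetric]
        inner_add_right matrix_vector_mul_assoc[symmetric] inner_vector_matrix_mult)
  ultimately show ?thesis
    using \<open>0 \<le> N\<close> by (simp add: add_pos_nonneg)
qed

lemma lpk_solutionE:
  fixes Mr :: "real^'r^'r" and Mq :: "real^'q^'q" and Gr :: "real^'r^'q"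
    and \<gamma>r :: "real^'r^'r" and \<gamma>q :: "real^'q^'q"
  assumes sol: "lpk_solution Mr Mq Gr \<gamma>r \<gamma>q Nreal rin sv \<mu>in r s \<mu>" and "P1 \<mu>in"
  obtains a where "\<And>t. 0 \<le> t \<Longrightarrow> (r has_vector_derivative s t) (at t within {0..})"
    and "\<And>t. 0 \<le> t \<Longrightarrow> (s has_vector_derivative a t) (at t within {0..})"
    and "\<And>t. 0 \<le> t \<Longrightarrow> (Mr + Nreal *\<^sub>R (transpose Gr ** Mq ** Gr)) *v a t
      = - (\<gamma>r *v r t) + Nreal *\<^sub>R ((transpose Gr ** \<gamma>q) *v ((\<integral>q. q \<partial>\<mu>in) - Gr *v (r t - rin)))"
    and "\<And>t. 0 \<le> t \<Longrightarrow> \<mu> t = distr \<mu>in borel (\<lambda>q. q - Gr *v (r t - rin))"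
proof -
  from sol obtain a Q where r0: "r 0 = rin"
    and r': "\<And>t. 0 \<le> t \<Longrightarrow> (r has_vector_derivative s t) (at t within {0..})"
    and s': "\<And>t. 0 \<le> t \<Longrightarrow> (s has_vector_derivative a t) (at t within {0..})"
    and eq: "\<And>t. 0 \<le> t \<Longrightarrow> (Mr + Nreal *\<^sub>R (\<integral>q. transpose Gr ** Mq ** Gr \<partial>\<mu> t)) *v a t
      = - (\<gamma>r *v r t) + Nreal *\<^sub>R ((transpose Gr ** \<gamma>q) *v (\<integral>q. q \<partial>\<mu> t))"
    and Q0: "\<And>q. Q 0 q = q"
    and Q': "\<And>t q. 0 \<le> t \<Longrightarrow> ((\<lambda>\<tau>. Q \<tau> q) has_vector_derivative - (Gr *v s t)) (at t within {0..})"
    and \<mu>: "\<And>t. 0 \<le> t \<Longrightarrow> \<mu> t = distr \<mu>in borel (Q t)"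
    unfolding lpk_solution_def by blast
  have Q: "Q t = (\<lambda>q. q - Gr *v (r t - rin))" if "0 \<le> t" for t
    using flow_eq_translation[OF r' Q' that] Q0 r0 by auto
  have \<mu>_translate: "\<mu> t = distr \<mu>in borel (\<lambda>q. q - Gr *v (r t - rin))" if "0 \<le> t" for t
    using \<mu>[OF that] Q[OF that] by simp
  have const: "(\<integral>q. M \<partial>\<mu> t) = M" if "0 \<le> t" for t and M :: "real^'r^'r"
  proof -
    interpret prob_space "\<mu> t"
      unfolding \<mu>_translate[OF that] using P1_distr_translate[OF \<open>P1 \<mu>in\<close>] by (rule prob_space_P1)
    show ?thesis by (simp add: prob_space)
  qed
  have mean: "(\<integral>q. q \<partial>\<mu> t) = (\<integral>q. q \<partial>\<mu>in) - Gr *v (r t - rin)" if "0 \<le> t" for t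
    unfolding \<mu>_translate[OF that] using \<open>P1 \<mu>in\<close> by (rule integral_id_distr_translate)
  show ?thesis
  proof (rule that[OF r' s' _ \<mu>_translate])
    fix t :: real assume "0 \<le> t"
    show "(Mr + Nreal *\<^sub>R (transpose Gr ** Mq ** Gr)) *v a t
      = - (\<gamma>r *v r t) + Nreal *\<^sub>R ((transpose Gr ** \<gamma>q) *v ((\<integral>q. q \<partial>\<mu>in) - Gr *v (r t - rin)))"
      using eq[OF \<open>0 \<le> t\<close>] unfolding const[OF \<open>0 \<le> t\<close>] mean[OF \<open>0 \<le> t\<close>] .
  qed
qed

lemma norm_matrix_vector_le: "norm (A *v x) \<le> onorm ((*v) A) * norm x"
  for A :: "real^'n^'m"
  by (rule onorm[OF matrix_vector_mul_bounded_linear])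

lemma onorm_matrix_nonneg: "0 \<le> onorm ((*v) A)"
  for A :: "real^'n^'m"
  by (rule onorm_pos_le[OF matrix_vector_mul_bounded_linear])

lemma norm_matrix_affine_diff_le:
  fixes S :: "real^'a^'b" and F :: "real^'c^'b" and G :: "real^'a^'c"
  shows "norm ((F *v (m1 + G *v y1) - S *v x1) - (F *v (m2 + G *v y2) - S *v x2))
    \<le> onorm ((*v) S) * norm (x1 - x2) + onorm ((*v) F) * (norm (m1 - m2) + onorm ((*v) G) * norm (y1 - y2))"
proof -
  have eq: "(F *v (m1 + G *v y1) - S *v x1) - (F *v (m2 + G *v y2) - S *v x2)
      = F *v (m1 - m2 + G *v (y1 - y2)) - S *v (x1 - x2)"
    by (simp add: algebra_simps matrix_vector_right_distrib)
  have "norm (m1 - m2 + G *v (y1 - y2)) \<le> norm (m1 - m2) + onorm ((*v) G) * norm (y1 - y2)"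
    using norm_triangle_ineq[of "m1 - m2" "G *v (y1 - y2)"] norm_matrix_vector_le[of G "y1 - y2"]
    by linarith
  then have "norm (F *v (m1 - m2 + G *v (y1 - y2)))
      \<le> onorm ((*v) F) * (norm (m1 - m2) + onorm ((*v) G) * norm (y1 - y2))"
    by (rule order_trans[OF norm_matrix_vector_le mult_left_mono[OF _ onorm_matrix_nonneg]])
  then show ?thesis
    unfolding eq using norm_triangle_ineq4[of "F *v (m1 - m2 + G *v (y1 - y2))" "S *v (x1 - x2)"]
      norm_matrix_vector_le[of S "x1 - x2"]
    by linarith
qed

lemma lpk_W1_le:
  fixes Mr :: "real^'r^'r" and Mq :: "real^'q^'q" and Gr :: "real^'r^'q"
    and \<gamma>r :: "real^'r^'r" and \<gamma>q :: "real^'q^'q"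
  assumes "P1 \<mu>in1" "P1 \<mu>in2"
    and "lpk_solution Mr Mq Gr \<gamma>r \<gamma>q Nreal rin1 sv1 \<mu>in1 r1 s1 \<mu>1"
    and "lpk_solution Mr Mq Gr \<gamma>r \<gamma>q Nreal rin2 sv2 \<mu>in2 r2 s2 \<mu>2"
    and "0 \<le> t"
  shows "W1 (\<mu>1 t) (\<mu>2 t) \<le> W1 \<mu>in1 \<mu>in2 + onorm ((*v) Gr) * (norm (r1 t - r2 t) + norm (rin1 - rin2))"
proof -
  have "\<mu>1 t = distr \<mu>in1 borel (\<lambda>q. q - Gr *v (r1 t - rin1))"
    using lpk_solutionE[OF assms(3,1)] \<open>0 \<le> t\<close> by metis
  moreover have "\<mu>2 t = distr \<mu>in2 borel (\<lambda>q. q - Gr *v (r2 t - rin2))"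
    using lpk_solutionE[OF assms(4,2)] \<open>0 \<le> t\<close> by metis
  ultimately have "W1 (\<mu>1 t) (\<mu>2 t) \<le> W1 \<mu>in1 \<mu>in2 + norm (Gr *v (r1 t - rin1) - Gr *v (r2 t - rin2))"
    using W1_distr_translate_le[OF assms(1,2)] by simp
  also have "Gr *v (r1 t - rin1) - Gr *v (r2 t - rin2) = Gr *v ((r1 t - r2 t) - (rin1 - rin2))"
    by (simp add: matrix_vector_mult_diff_distrib)
  also have "norm \<dots> \<le> onorm ((*v) Gr) * (norm (r1 t - r2 t) + norm (rin1 - rin2))"
    by (rule order_trans[OF norm_matrix_vector_le mult_left_mono[OF norm_triangle_ineq4 onorm_matrix_nonneg]])
  finally show ?thesis by simp
qed

locale lpk_system =
  fixes Mr :: "real^'r^'r" and Mq :: "real^'q^'q" and Gr :: "real^'r^'q"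
    and \<gamma>r :: "real^'r^'r" and \<gamma>q :: "real^'q^'q" and Nreal :: real
  assumes Mr_pos_def: "sym_pos_def_mat Mr" and Mq_pos_def: "sym_pos_def_mat Mq"
    and Nreal_pos: "0 < Nreal"
begin

definition mass :: "real^'r^'r"
  where "mass = Mr + Nreal *\<^sub>R (transpose Gr ** Mq ** Gr)"

definition stiffness :: "real^'r^'r"
  where "stiffness = matrix_inv mass ** (\<gamma>r + Nreal *\<^sub>R (transpose Gr ** \<gamma>q ** Gr))"

definition forcing :: "real^'q^'r"
  where "forcing = Nreal *\<^sub>R (matrix_inv mass ** transpose Gr ** \<gamma>q)"

definition rate :: real
  where "rate = 2 + onorm ((*v) stiffness)"

definition gain :: real
  where "gain = (1 + onorm ((*v) Gr)) * (3 + 2 * onorm ((*v) forcing) * (1 + onorm ((*v) Gr)))"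

lemma matrix_inv_mass: "matrix_inv mass ** mass = mat 1"
  unfolding mass_def using Nreal_pos
  by (intro matrix_inv_left invertible_if_pos_def mass_matrix_pos_def Mr_pos_def Mq_pos_def) simp_all

lemma acceleration_eq:
  assumes "mass *v a = - (\<gamma>r *v x) + Nreal *\<^sub>R ((transpose Gr ** \<gamma>q) *v (m - Gr *v (x - x0)))"
  shows "a = forcing *v (m + Gr *v x0) - stiffness *v x"
proof -
  have "a = matrix_inv mass *v (mass *v a)"
    by (simp add: matrix_vector_mul_assoc matrix_inv_mass)
  also have "\<dots> = forcing *v (m + Gr *v x0) - stiffness *v x"
    unfolding assms forcing_def stiffness_def
    by (simp add: algebra_simps matrix_vector_mul_assoc[symmetric] scaleR_matrix_vector_assoc[symmetric]
        matrix_vector_mult_add_rdistrib matrix_vector_right_distrib)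
  finally show ?thesis .
qed

lemma lpk_solution_ode:
  assumes "lpk_solution Mr Mq Gr \<gamma>r \<gamma>q Nreal rin sv \<mu>in r s \<mu>" and "P1 \<mu>in" and "0 \<le> t"
  shows "(r has_vector_derivative s t) (at t within {0..})"
    and "(s has_vector_derivative forcing *v ((\<integral>q. q \<partial>\<mu>in) + Gr *v rin) - stiffness *v r t)
      (at t within {0..})"
proof -
  obtain a where r': "(r has_vector_derivative s t) (at t within {0..})"
    and s': "(s has_vector_derivative a t) (at t within {0..})"
    and eq: "mass *v a t = - (\<gamma>r *v r t)
      + Nreal *\<^sub>R ((transpose Gr ** \<gamma>q) *v ((\<integral>q. q \<partial>\<mu>in) - Gr *v (r t - rin)))"
    using lpk_solutionE[OF assms(1,2)] \<open>0 \<le> t\<close> unfolding mass_def by metis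
  show "(r has_vector_derivative s t) (at t within {0..})"
    by (rule r')
  show "(s has_vector_derivative forcing *v ((\<integral>q. q \<partial>\<mu>in) + Gr *v rin) - stiffness *v r t)
      (at t within {0..})"
    using s' unfolding acceleration_eq[OF eq] .
qed

lemma norm_acceleration_diff_le:
  assumes "P1 \<mu>in1" "P1 \<mu>in2"
  shows "norm ((forcing *v ((\<integral>q. q \<partial>\<mu>in1) + Gr *v rin1) - stiffness *v x1)
      - (forcing *v ((\<integral>q. q \<partial>\<mu>in2) + Gr *v rin2) - stiffness *v x2))
    \<le> onorm ((*v) stiffness) * norm (x1 - x2)
      + onorm ((*v) forcing) * (W1 \<mu>in1 \<mu>in2 + onorm ((*v) Gr) * norm (rin1 - rin2))"
proof -
  have "onorm ((*v) forcing) * (norm ((\<integral>q. q \<partial>\<mu>in1) - (\<integral>q. q \<partial>\<mu>in2)) + onorm ((*v) Gr) * norm (rin1 - rin2))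
      \<le> onorm ((*v) forcing) * (W1 \<mu>in1 \<mu>in2 + onorm ((*v) Gr) * norm (rin1 - rin2))"
    using norm_mean_diff_le_W1[OF assms] by (intro mult_left_mono onorm_matrix_nonneg) simp_all
  with norm_matrix_affine_diff_le show ?thesis
    by (rule order_trans[OF _ add_left_mono])
qed

lemma lpk_difference_growth:
  assumes "P1 \<mu>in1" "P1 \<mu>in2"
    and sol1: "lpk_solution Mr Mq Gr \<gamma>r \<gamma>q Nreal rin1 sv1 \<mu>in1 r1 s1 \<mu>1"
    and sol2: "lpk_solution Mr Mq Gr \<gamma>r \<gamma>q Nreal rin2 sv2 \<mu>in2 r2 s2 \<mu>2"
    and "0 \<le> t"
  shows "norm (r1 t - r2 t) + norm (s1 t - s2 t)
    \<le> 2 * (norm (rin1 - rin2) + norm (sv1 - sv2)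
        + onorm ((*v) forcing) * (W1 \<mu>in1 \<mu>in2 + onorm ((*v) Gr) * norm (rin1 - rin2)))
      * exp (rate * t)"
proof -
  define k where "k = onorm ((*v) forcing) * (W1 \<mu>in1 \<mu>in2 + onorm ((*v) Gr) * norm (rin1 - rin2))"
  define a1 a2 where "a1 \<tau> = forcing *v ((\<integral>q. q \<partial>\<mu>in1) + Gr *v rin1) - stiffness *v r1 \<tau>"
    and "a2 \<tau> = forcing *v ((\<integral>q. q \<partial>\<mu>in2) + Gr *v rin2) - stiffness *v r2 \<tau>" for \<tau>
  have "0 \<le> k"
    unfolding k_def using W1_nonneg[OF assms(1,2)] by (simp add: onorm_matrix_nonneg)
  have "norm (r1 t - r2 t) + norm (s1 t - s2 t)
      \<le> 2 * (norm (r1 0 - r2 0) + norm (s1 0 - s2 0) + k) * exp ((2 + onorm ((*v) stiffness)) * t)"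
  proof (rule second_order_growth_bound[where d = "\<lambda>\<tau>. r1 \<tau> - r2 \<tau>" and e = "\<lambda>\<tau>. s1 \<tau> - s2 \<tau>"
        and a = "\<lambda>\<tau>. a1 \<tau> - a2 \<tau>"])
    show "((\<lambda>\<tau>. r1 \<tau> - r2 \<tau>) has_vector_derivative s1 \<tau> - s2 \<tau>) (at \<tau> within {0..})"
      and "((\<lambda>\<tau>. s1 \<tau> - s2 \<tau>) has_vector_derivative a1 \<tau> - a2 \<tau>) (at \<tau> within {0..})"
      if "0 \<le> \<tau>" for \<tau>
      using lpk_solution_ode[OF sol1 assms(1) that] lpk_solution_ode[OF sol2 assms(2) that]
      unfolding a1_def a2_def by (auto intro: has_vector_derivative_diff)
    show "norm (a1 \<tau> - a2 \<tau>) \<le> onorm ((*v) stiffness) * norm (r1 \<tau> - r2 \<tau>) + k" for \<tau>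
      unfolding a1_def a2_def k_def using assms(1,2) by (rule norm_acceleration_diff_le)
  qed (use onorm_matrix_nonneg \<open>0 \<le> k\<close> \<open>0 \<le> t\<close> in auto)
  moreover have "r1 0 - r2 0 = rin1 - rin2" "s1 0 - s2 0 = sv1 - sv2"
    using sol1 sol2 unfolding lpk_solution_def by simp_all
  ultimately show ?thesis
    unfolding k_def rate_def by simp
qed

lemma lpk_stability:
  assumes "P1 \<mu>in1" "P1 \<mu>in2"
    and "lpk_solution Mr Mq Gr \<gamma>r \<gamma>q Nreal rin1 sv1 \<mu>in1 r1 s1 \<mu>1"
    and "lpk_solution Mr Mq Gr \<gamma>r \<gamma>q Nreal rin2 sv2 \<mu>in2 r2 s2 \<mu>2"
    and "0 \<le> t"
  shows "norm (r1 t - r2 t) + norm (s1 t - s2 t) + W1 (\<mu>1 t) (\<mu>2 t)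
    \<le> gain * exp (rate * t) * (norm (rin1 - rin2) + norm (sv1 - sv2) + W1 \<mu>in1 \<mu>in2)"
proof -
  define KG KF where "KG = onorm ((*v) Gr)" and "KF = onorm ((*v) forcing)"
  define S X c where "S = norm (r1 t - r2 t) + norm (s1 t - s2 t)"
    and "X = norm (rin1 - rin2) + norm (sv1 - sv2) + W1 \<mu>in1 \<mu>in2" and "c = exp (rate * t)"
  define I where "I = W1 \<mu>in1 \<mu>in2 + KG * norm (rin1 - rin2)"
  have "0 \<le> KG" "0 \<le> KF" "0 \<le> W1 \<mu>in1 \<mu>in2" "1 \<le> c"
    unfolding KG_def KF_def c_def rate_def using \<open>0 \<le> t\<close> W1_nonneg[OF assms(1,2)]
    by (simp_all add: onorm_matrix_nonneg)
  then have "0 \<le> (1 + KG) * X" and I_le: "I \<le> (1 + KG) * X"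
    unfolding X_def I_def using mult_nonneg_nonneg[of KG "W1 \<mu>in1 \<mu>in2"] mult_nonneg_nonneg[of KG "norm (sv1 - sv2)"]
    by (simp_all add: algebra_simps)
  then have "2 * (norm (rin1 - rin2) + norm (sv1 - sv2) + KF * I) * c \<le> 2 * ((1 + KF * (1 + KG)) * X) * c"
    using mult_left_mono[OF I_le \<open>0 \<le> KF\<close>] \<open>0 \<le> W1 \<mu>in1 \<mu>in2\<close> \<open>1 \<le> c\<close> unfolding X_def
    by (intro mult_right_mono) (simp_all add: algebra_simps)
  with lpk_difference_growth[OF assms] have growth: "S \<le> 2 * ((1 + KF * (1 + KG)) * X) * c"
    unfolding S_def I_def KG_def KF_def c_def by linarith
  have "S + W1 (\<mu>1 t) (\<mu>2 t) \<le> (1 + KG) * S + I"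
    using lpk_W1_le[OF assms] mult_nonneg_nonneg[OF \<open>0 \<le> KG\<close> norm_ge_zero[of "s1 t - s2 t"]]
    unfolding S_def I_def KG_def by (simp add: algebra_simps)
  also have "\<dots> \<le> (1 + KG) * (2 * ((1 + KF * (1 + KG)) * X) * c) + (1 + KG) * X * c"
  proof -
    have "(1 + KG) * S \<le> (1 + KG) * (2 * ((1 + KF * (1 + KG)) * X) * c)"
      using growth \<open>0 \<le> KG\<close> by (intro mult_left_mono) simp_all
    moreover have "(1 + KG) * X \<le> (1 + KG) * X * c"
      using mult_left_mono[OF \<open>1 \<le> c\<close> \<open>0 \<le> (1 + KG) * X\<close>] by simp
    ultimately show ?thesis
      using I_le by linarith
  qed
  also have "\<dots> = gain * c * X"
    unfolding gain_def KG_def KF_def by (simp add: algebra_simps)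
  finally show ?thesis
    unfolding S_def X_def c_def by (simp only: mult_ac)
qed

end

theorem theorem1:
  fixes Mr :: "real^'r^'r" and Mq :: "real^'q^'q" and Gr :: "real^'r^'q"
    and \<gamma>r :: "real^'r^'r" and \<gamma>q :: "real^'q^'q" and Nreal :: real
  assumes "sym_pos_def_mat Mr" and "sym_pos_def_mat Mq" and "Nreal > 0"
  shows "\<exists>L C. L > 0 \<and> C > 0 \<and>
    (\<forall>rin1 sv1 \<mu>in1 r1 s1 \<mu>1 rin2 sv2 \<mu>in2 r2 s2 \<mu>2.
       P1 \<mu>in1 \<longrightarrow> P1 \<mu>in2 \<longrightarrow>
       (\<forall>t\<ge>0. P1 (\<mu>1 t) \<and> P1 (\<mu>2 t)) \<longrightarrow>
       lpk_solution Mr Mq Gr \<gamma>r \<gamma>q Nreal rin1 sv1 \<mu>in1 r1 s1 \<mu>1 \<longrightarrow>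
       lpk_solution Mr Mq Gr \<gamma>r \<gamma>q Nreal rin2 sv2 \<mu>in2 r2 s2 \<mu>2 \<longrightarrow>
       (\<forall>t\<ge>0. norm (r1 t - r2 t) + norm (s1 t - s2 t) + W1 (\<mu>1 t) (\<mu>2 t)
          \<le> C * exp (L * t) * (norm (rin1 - rin2) + norm (sv1 - sv2) + W1 \<mu>in1 \<mu>in2)))"
proof -
  interpret lpk_system Mr Mq Gr \<gamma>r \<gamma>q Nreal
    using assms by unfold_locales
  have "0 < rate" "0 < gain"
    unfolding rate_def gain_def by (simp_all add: onorm_matrix_nonneg add_pos_nonneg)
  with lpk_stability show ?thesis
    by (intro exI[of _ rate] exI[of _ gain]) simp
qed

end
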